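(* Let $0<m<L$, $\kappa:=Lm^{-1}$, $\rho\in(0,1)$ and let $l\in\mathbb N$ with $l\ge1$. Then there exists some $\Lambda=(\Lambda_l,\dots,\Lambda_1,\Lambda_0)\in\mathbf\Lambda^r_\rho$ such that, with $R:=\sum_{k=0}^l\rho^k(\Lambda_kLm^{-1})$, $$\begin{pmatrix}\frac1{1-\rho^2}(R^T+R)&R^T+\Lambda_0\\R+\Lambda_0^T&\Lambda_0^T+\Lambda_0\end{pmatrix}\succ0$$ if and only if $$1-\frac1{\sqrt\kappa}<\rho.$$
   Context: $\mathbf\Lambda^r_\rho$ is the set of all tuples $(\Lambda_l,\dots,\Lambda_1,\Lambda_0)$ of $d\times d$ matrices with $\Lambda_i=\lambda_iI_d$, $\lambda_i\in\mathbb R$, $\lambda_i\le0$ for $i=1,\dots,l$, $\sum_{i=0}^l\lambda_i\rho^i\ge0$ and $\sum_{i=0}^l\lambda_i\rho^{-i}\ge0$. $M\succ0$ means real symmetric positive definite. *)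

theory Defs
  imports "HOL-Analysis.Analysis"
begin

definition pos_def :: "real^'n^'n \<Rightarrow> bool" where
  "pos_def M \<longleftrightarrow> transpose M = M \<and> (\<forall>x. x \<noteq> 0 \<longrightarrow> 0 < x \<bullet> (M *v x))"

(* Block matrix with rows (A, B) and (C, D), indexed by disjoint sums. *)
definition block_matrix ::
  "'a^'n^'m \<Rightarrow> 'a^'k^'m \<Rightarrow> 'a^'n^'p \<Rightarrow> 'a^'k^'p \<Rightarrow> 'a^('n + 'k)^('m + 'p)" where
  "block_matrix A B C D = (\<chi> i j. case i of
      Inl r \<Rightarrow> (case j of Inl s \<Rightarrow> A $ r $ s | Inr s \<Rightarrow> B $ r $ s)
    | Inr r \<Rightarrow> (case j of Inl s \<Rightarrow> C $ r $ s | Inr s \<Rightarrow> D $ r $ s))"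

(* A tuple with indices 0, ..., l is a function that is undefined outside {0..l},
   so that functions and tuples correspond one to one. *)
definition Lambda_r :: "nat \<Rightarrow> real \<Rightarrow> (nat \<Rightarrow> real^'d^'d) set" where
  "Lambda_r l \<rho> = {\<Lambda> \<in> extensional {0..l}. \<exists>c :: nat \<Rightarrow> real.
      (\<forall>i\<in>{0..l}. \<Lambda> i = c i *\<^sub>R mat 1) \<and>
      (\<forall>i\<in>{1..l}. c i \<le> 0) \<and>
      0 \<le> (\<Sum>i=0..l. c i * \<rho> ^ i) \<and>
      0 \<le> (\<Sum>i=0..l. c i * \<rho> powi (- int i))}"

end

theory Submission imports Defs begin

text \<open>All blocks are multiples of the identity, so the condition is that a real
  \<open>2 \<times> 2\<close> matrix is positive definite. With \<open>t = \<kappa> (\<Sum>k. \<lambda>\<^sub>k \<rho>\<^sup>k) / \<lambda>\<^sub>0\<close> it becomes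
  \<open>(1 - \<rho>) / (1 + \<rho>) < t < (1 + \<rho>) / (1 - \<rho>)\<close>, while the constraints on the
  multipliers allow exactly \<open>\<kappa> (1 - \<rho>\<^sup>2) \<le> t \<le> \<kappa>\<close>, the whole range being attained with
  \<open>\<lambda>\<^sub>0\<close> and \<open>\<lambda>\<^sub>1\<close> alone. As \<open>\<kappa> > 1\<close>, the two intervals meet iff \<open>\<kappa> (1 - \<rho>)\<^sup>2 < 1\<close>.\<close>

lemma sum_UNIV_Plus:
  fixes f :: "'a::finite + 'b::finite \<Rightarrow> 'c::comm_monoid_add"
  shows "sum f UNIV = (\<Sum>i\<in>UNIV. f (Inl i)) + (\<Sum>i\<in>UNIV. f (Inr i))"
  by (simp only: UNIV_Plus_UNIV[symmetric] sum.Plus[OF finite finite] o_def)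

lemma transpose_scaleR_mat_1: "transpose (a *\<^sub>R mat 1 :: real^'n^'n) = a *\<^sub>R mat 1"
  by (simp add: transpose_def mat_def vec_eq_iff)

text \<open>Scalar blocks couple only the coordinates \<open>Inl i\<close> and \<open>Inr i\<close>
  with the same \<open>i\<close>, so the form splits into copies of one binary quadratic
  form.\<close>

lemma inner_block_matrix_scaleR_mat_1:
  fixes x :: "real^('n::finite + 'n)"
  shows "x \<bullet> (block_matrix (a *\<^sub>R mat 1) (b *\<^sub>R mat 1) (b *\<^sub>R mat 1) (d *\<^sub>R mat 1) *v x)
    = (\<Sum>i\<in>UNIV. a * (x $ Inl i)\<^sup>2 + 2 * b * x $ Inl i * x $ Inr i + d * (x $ Inr i)\<^sup>2)"
    (is "x \<bullet> (?M *v x) = _")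
proof -
  have "(?M *v x) $ Inl i = a * x $ Inl i + b * x $ Inr i"
    "(?M *v x) $ Inr i = b * x $ Inl i + d * x $ Inr i" for i
    by (simp_all add: matrix_vector_mult_def sum_UNIV_Plus block_matrix_def mat_def
        if_distrib[where f="\<lambda>z. z * _"] if_distrib[where f="\<lambda>z. _ * z"] cong: if_cong)
  then show ?thesis
    by (simp add: inner_vec_def sum_UNIV_Plus sum.distrib[symmetric] algebra_simps
        power2_eq_square)
qed

text \<open>Complete the square after multiplying by \<open>a\<close>. If \<open>v = 0\<close>, then
  \<open>u\<close> is nonzero and the first square is positive; otherwise the second term
  is.\<close>

lemma quadratic_form_pos:
  fixes a b d u v :: real
  assumes "0 < a" "b\<^sup>2 < a * d" "u \<noteq> 0 \<or> v \<noteq> 0"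
  shows "0 < a * u\<^sup>2 + 2 * b * u * v + d * v\<^sup>2"
proof -
  have "a * (a * u\<^sup>2 + 2 * b * u * v + d * v\<^sup>2) = (a * u + b * v)\<^sup>2 + (a * d - b\<^sup>2) * v\<^sup>2"
    by (simp add: power2_eq_square algebra_simps)
  also have "\<dots> > 0"
    using assms by (cases "v = 0") (auto intro!: add_nonneg_pos)
  finally show ?thesis
    using \<open>0 < a\<close> by (simp add: zero_less_mult_iff)
qed

text \<open>Sylvester's criterion for the 2 by 2 matrix with rows \<open>(a, b)\<close> and
  \<open>(b, d)\<close>, of which the block matrix is the Kronecker product with the
  identity.\<close>

lemma pos_def_block_matrix_scaleR_mat_1:
  "pos_def (block_matrix (a *\<^sub>R mat 1) (b *\<^sub>R mat 1) (b *\<^sub>R mat 1) (d *\<^sub>R mat 1)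
      :: real^('n::finite + 'n)^('n + 'n))
    \<longleftrightarrow> 0 < a \<and> b\<^sup>2 < a * d"
    (is "pos_def ?M \<longleftrightarrow> _")
proof
  assume "pos_def ?M"
  then have pos: "0 < x \<bullet> (?M *v x)" if "x \<noteq> 0" for x
    using that by (simp add: pos_def_def)
  \<comment> \<open>Types are nonempty, so some index exists. Vectors supported on
    \<open>Inl k\<close> and \<open>Inr k\<close> recover the binary form.\<close>
  obtain k :: 'n where True by simp
  define w :: "real \<Rightarrow> real \<Rightarrow> real^('n + 'n)" where
    "w u v = (\<chi> j. if j = Inl k then u else if j = Inr k then v else 0)" for u v
  have form: "w u v \<bullet> (?M *v w u v) = a * u\<^sup>2 + 2 * b * u * v + d * v\<^sup>2" for u v
  proof -
    have "w u v \<bullet> (?M *v w u v)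
        = (\<Sum>i\<in>UNIV. if i = k then a * u\<^sup>2 + 2 * b * u * v + d * v\<^sup>2 else 0)"
      unfolding inner_block_matrix_scaleR_mat_1 by (intro sum.cong) (auto simp: w_def)
    then show ?thesis by simp
  qed
  have pos': "0 < a * u\<^sup>2 + 2 * b * u * v + d * v\<^sup>2" if "u \<noteq> 0 \<or> v \<noteq> 0" for u v
  proof -
    have "w u v $ Inl k = u" "w u v $ Inr k = v"
      by (simp_all add: w_def)
    with that have "w u v \<noteq> 0"
      by auto
    from pos[OF this] show ?thesis
      by (simp add: form)
  qed
  have "0 < a"
    using pos'[of 1 0] by simp
  \<comment> \<open>The vector \<open>(- b, a)\<close> annihilates the square
    \<open>(a * u + b * v)\<^sup>2\<close>, leaving only the determinant term.\<close>
  moreover have "0 < a * (a * d - b\<^sup>2)"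
    using pos'[of "- b" a] \<open>0 < a\<close> by (simp add: power2_eq_square algebra_simps)
  ultimately show "0 < a \<and> b\<^sup>2 < a * d"
    by (simp add: zero_less_mult_iff)
next
  assume ab: "0 < a \<and> b\<^sup>2 < a * d"
  have "transpose ?M = ?M"
    by (auto simp: transpose_def vec_eq_iff block_matrix_def mat_def split: sum.split)
  moreover have "0 < x \<bullet> (?M *v x)" if nonzero: "x \<noteq> 0" for x
  proof -
    have form_pos: "0 < a * u\<^sup>2 + 2 * b * u * v + d * v\<^sup>2" if "u \<noteq> 0 \<or> v \<noteq> 0" for u v
      using quadratic_form_pos ab that by blast
    obtain j where "x $ j \<noteq> 0"
      using nonzero by (auto simp: vec_eq_iff)
    then obtain k where k: "x $ Inl k \<noteq> 0 \<or> x $ Inr k \<noteq> 0"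
      by (cases j) auto
    show ?thesis
      unfolding inner_block_matrix_scaleR_mat_1
    proof (rule sum_pos2[where i=k])
      fix i
      show "0 \<le> a * (x $ Inl i)\<^sup>2 + 2 * b * x $ Inl i * x $ Inr i + d * (x $ Inr i)\<^sup>2"
        using form_pos[of "x $ Inl i" "x $ Inr i"]
        by (cases "x $ Inl i \<noteq> 0 \<or> x $ Inr i \<noteq> 0") (auto intro: less_imp_le)
    qed (use form_pos[OF k] in auto)
  qed
  ultimately show "pos_def ?M"
    by (simp add: pos_def_def)
qed

text \<open>Here \<open>R\<close> is \<open>s\<close> times the identity, so the criterion applies
  with entries \<open>2 * s / (1 - \<rho>\<^sup>2)\<close>, \<open>s + c 0\<close> and
  \<open>2 * c 0\<close>; it remains to clear the positive denominator.\<close>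

lemma multiplier_matrix_pos_def_iff:
  fixes \<Lambda> :: "nat \<Rightarrow> real^'d::finite^'d"
  assumes \<Lambda>: "\<And>i. i \<le> l \<Longrightarrow> \<Lambda> i = c i *\<^sub>R mat 1" and \<rho>: "0 < \<rho>" "\<rho> < 1"
    and s: "s = \<kappa> * (\<Sum>i=0..l. c i * \<rho> ^ i)"
  shows "(let R = (\<Sum>k=0..l. \<rho> ^ k *\<^sub>R (\<kappa> *\<^sub>R \<Lambda> k)) in
      pos_def (block_matrix
        ((1 / (1 - \<rho>\<^sup>2)) *\<^sub>R (transpose R + R)) (transpose R + \<Lambda> 0)
        (R + transpose (\<Lambda> 0))                   (transpose (\<Lambda> 0) + \<Lambda> 0)))
    \<longleftrightarrow> 0 < s \<and> (1 - \<rho>\<^sup>2) * (s + c 0)\<^sup>2 < 4 * s * c 0"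
proof -
  have "\<rho>\<^sup>2 < 1"
    using \<rho> by (simp add: power_less_one_iff)
  have R: "(\<Sum>k=0..l. \<rho> ^ k *\<^sub>R (\<kappa> *\<^sub>R \<Lambda> k)) = s *\<^sub>R mat 1"
    unfolding s sum_distrib_left scaleR_sum_left
    by (intro sum.cong) (auto simp: \<Lambda> mult_ac)
  have blocks:
    "(1 / (1 - \<rho>\<^sup>2)) *\<^sub>R (transpose (s *\<^sub>R mat 1 :: real^'d^'d) + s *\<^sub>R mat 1)
      = (2 * s / (1 - \<rho>\<^sup>2)) *\<^sub>R mat 1"
    "transpose (s *\<^sub>R mat 1 :: real^'d^'d) + \<Lambda> 0 = (s + c 0) *\<^sub>R mat 1"
    "s *\<^sub>R mat 1 + transpose (\<Lambda> 0) = (s + c 0) *\<^sub>R mat 1"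
    "transpose (\<Lambda> 0) + \<Lambda> 0 = (2 * c 0) *\<^sub>R mat 1"
    by (simp_all add: \<Lambda> transpose_scaleR_mat_1 scaleR_add_left[symmetric])
  show ?thesis
    unfolding R Let_def blocks pos_def_block_matrix_scaleR_mat_1
    using \<open>\<rho>\<^sup>2 < 1\<close> by (simp add: field_simps)
qed

text \<open>The difference of the two sides is a product of two linear forms in \<open>s\<close> and
  \<open>c\<close>. The second factor exceeds the first by \<open>2 * \<rho> * (s + c) > 0\<close>,
  so the product is negative exactly when the first is negative and the second positive.\<close>

lemma discriminant_iff:
  fixes s c \<rho> :: real
  assumes "0 < \<rho>" "\<rho> < 1" "0 < s" "0 < c"
  shows "(1 - \<rho>\<^sup>2) * (s + c)\<^sup>2 < 4 * s * c
    \<longleftrightarrow> (1 - \<rho>) * s < (1 + \<rho>) * c \<and> (1 - \<rho>) * c < (1 + \<rho>) * s"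
proof -
  have "(1 - \<rho>\<^sup>2) * (s + c)\<^sup>2 - 4 * s * c
      = ((1 - \<rho>) * s - (1 + \<rho>) * c) * ((1 + \<rho>) * s - (1 - \<rho>) * c)"
    by (simp add: power2_eq_square algebra_simps)
  then have "(1 - \<rho>\<^sup>2) * (s + c)\<^sup>2 < 4 * s * c
      \<longleftrightarrow> ((1 - \<rho>) * s - (1 + \<rho>) * c) * ((1 + \<rho>) * s - (1 - \<rho>) * c) < 0"
    by linarith
  moreover have "(1 - \<rho>) * s - (1 + \<rho>) * c < (1 + \<rho>) * s - (1 - \<rho>) * c"
    using assms by (simp add: algebra_simps) (smt (verit) mult_pos_pos)
  ultimately show ?thesis
    unfolding mult_less_0_iff by linarith
qed

text \<open>Scaling the constraint by \<open>\<rho>\<^sup>2\<close> makes the two sums comparable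
  term by term: for \<open>i \<ge> 1\<close> the weight \<open>\<rho> ^ i\<close> is at most
  \<open>\<rho>\<^sup>2 * \<rho> powi (- int i)\<close>, and \<open>c i \<le> 0\<close> reverses
  this. Equality of the weights at \<open>i = 1\<close> is why \<open>c 1\<close> alone can attain
  the bound.\<close>

lemma multiplier_sum_lower_bound:
  fixes c :: "nat \<Rightarrow> real"
  assumes \<rho>: "0 < \<rho>" "\<rho> < 1" and neg: "\<And>i. i \<in> {1..l} \<Longrightarrow> c i \<le> 0"
    and nonneg: "0 \<le> (\<Sum>i=0..l. c i * \<rho> powi (- int i))"
  shows "(1 - \<rho>\<^sup>2) * c 0 \<le> (\<Sum>i=0..l. c i * \<rho> ^ i)"
proof -
  have term_le: "\<rho>\<^sup>2 * (c i * \<rho> powi (- int i)) \<le> c i * \<rho> ^ i" if "i \<in> {1..l}" for i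
  proof -
    have "\<rho> ^ i * \<rho> ^ i \<le> \<rho>\<^sup>2"
      using that \<rho> power_decreasing[of 2 "i + i" \<rho>] by (simp add: power_add)
    then have "\<rho> ^ i \<le> \<rho>\<^sup>2 * \<rho> powi (- int i)"
      using \<rho> by (simp add: power_int_minus field_simps)
    from mult_left_mono_neg[OF this neg[OF that]] show ?thesis
      by (simp add: mult_ac)
  qed
  have "0 \<le> \<rho>\<^sup>2 * (\<Sum>i=0..l. c i * \<rho> powi (- int i))"
    using nonneg by simp
  also have "\<dots> = \<rho>\<^sup>2 * c 0 + (\<Sum>i=1..l. \<rho>\<^sup>2 * (c i * \<rho> powi (- int i)))"
    by (simp add: sum.atLeast_Suc_atMost sum_distrib_left algebra_simps)
  also have "\<dots> \<le> \<rho>\<^sup>2 * c 0 + (\<Sum>i=1..l. c i * \<rho> ^ i)"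
    by (intro add_left_mono sum_mono term_le)
  also have "\<dots> = (\<Sum>i=0..l. c i * \<rho> ^ i) - (1 - \<rho>\<^sup>2) * c 0"
    by (simp add: sum.atLeast_Suc_atMost algebra_simps)
  finally show ?thesis by simp
qed

lemma one_minus_inverse_sqrt_less_iff:
  fixes \<kappa> \<rho> :: real
  assumes "0 < \<kappa>" "\<rho> < 1"
  shows "1 - 1 / sqrt \<kappa> < \<rho> \<longleftrightarrow> \<kappa> * (1 - \<rho>)\<^sup>2 < 1"
proof -
  have "1 - 1 / sqrt \<kappa> < \<rho> \<longleftrightarrow> sqrt \<kappa> * (1 - \<rho>) < 1"
    using assms by (simp add: field_simps)
  also have "\<dots> \<longleftrightarrow> (sqrt \<kappa> * (1 - \<rho>))\<^sup>2 < 1"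
    using assms by (simp add: abs_square_less_1 abs_mult)
  finally show ?thesis
    using assms by (simp add: power_mult_distrib)
qed

text \<open>Both sides of the first inequality share the positive factor \<open>1 + \<rho>\<close>.
  That inequality says that the least admissible ratio
  \<open>\<kappa> * (1 - \<rho>\<^sup>2)\<close> lies below the upper end
  \<open>(1 + \<rho>) / (1 - \<rho>)\<close>.\<close>

lemma interval_bound_iff:
  fixes \<kappa> \<rho> :: real
  assumes "0 < \<rho>"
  shows "(1 - \<rho>) * (\<kappa> * (1 - \<rho>\<^sup>2)) < 1 + \<rho> \<longleftrightarrow> \<kappa> * (1 - \<rho>)\<^sup>2 < 1"
proof -
  have "(1 - \<rho>) * (\<kappa> * (1 - \<rho>\<^sup>2)) = (1 + \<rho>) * (\<kappa> * (1 - \<rho>)\<^sup>2)"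
    by (simp add: power2_eq_square algebra_simps)
  then have "(1 - \<rho>) * (\<kappa> * (1 - \<rho>\<^sup>2)) < 1 + \<rho>
      \<longleftrightarrow> (1 + \<rho>) * (\<kappa> * (1 - \<rho>)\<^sup>2) < (1 + \<rho>) * 1"
    by (simp only: mult_1_right)
  then show ?thesis
    unfolding mult_less_cancel_left using assms by simp
qed

theorem corollary4p8:
  fixes m L \<kappa> \<rho> :: real and l :: nat
  assumes "0 < m" and "m < L" and "\<kappa> = L / m"
    and "\<rho> \<in> {0<..<1}" and "l \<ge> 1"
  shows "(\<exists>\<Lambda> \<in> (Lambda_r l \<rho> :: (nat \<Rightarrow> real^'d::finite^'d) set).
            let R = (\<Sum>k=0..l. \<rho> ^ k *\<^sub>R ((L / m) *\<^sub>R \<Lambda> k)) in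
              pos_def (block_matrix
                ((1 / (1 - \<rho>\<^sup>2)) *\<^sub>R (transpose R + R)) (transpose R + \<Lambda> 0)
                (R + transpose (\<Lambda> 0))                   (transpose (\<Lambda> 0) + \<Lambda> 0)))
         \<longleftrightarrow> 1 - 1 / sqrt \<kappa> < \<rho>"
    (is "(\<exists>\<Lambda>\<in>_. ?P \<Lambda>) \<longleftrightarrow> _")
proof -
  have \<rho>: "0 < \<rho>" "\<rho> < 1" "\<rho>\<^sup>2 < 1"
    using assms by (auto simp: power_less_one_iff)
  have \<kappa>: "1 < \<kappa>"
    using assms by simp
  show ?thesis
    unfolding one_minus_inverse_sqrt_less_iff[OF less_trans[OF zero_less_one \<kappa>] \<rho>(2)]
  proof
    assume "\<exists>\<Lambda>\<in>Lambda_r l \<rho>. ?P \<Lambda>"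
    then obtain \<Lambda> :: "nat \<Rightarrow> real^'d^'d" and c where "?P \<Lambda>"
      and \<Lambda>: "\<And>i. i \<le> l \<Longrightarrow> \<Lambda> i = c i *\<^sub>R mat 1"
      and neg: "\<And>i. i \<in> {1..l} \<Longrightarrow> c i \<le> 0"
      and nonneg: "0 \<le> (\<Sum>i=0..l. c i * \<rho> powi (- int i))"
      unfolding Lambda_r_def by fastforce
    define s where "s = \<kappa> * (\<Sum>i=0..l. c i * \<rho> ^ i)"
    have "0 < s" and disc: "(1 - \<rho>\<^sup>2) * (s + c 0)\<^sup>2 < 4 * s * c 0"
      using multiplier_matrix_pos_def_iff[of l \<Lambda> c \<rho> s \<kappa>, OF \<Lambda> \<rho>(1,2) s_def] \<open>?P \<Lambda>\<close>
      unfolding \<open>\<kappa> = L / m\<close> by blast+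
    \<comment> \<open>The discriminant inequality bounds a nonnegative quantity strictly by
      \<open>4 * s * c 0\<close>, so \<open>c 0\<close> has the sign of \<open>s\<close>.\<close>
    have "0 \<le> (1 - \<rho>\<^sup>2) * (s + c 0)\<^sup>2"
      using \<rho> by simp
    with disc \<open>0 < s\<close> have "0 < c 0"
      by (smt (verit) zero_less_mult_iff)
    have "\<kappa> * ((1 - \<rho>\<^sup>2) * c 0) \<le> s"
      unfolding s_def using multiplier_sum_lower_bound[OF \<rho>(1,2) neg nonneg] \<kappa>
      by (intro mult_left_mono) auto
    then have "(1 - \<rho>) * (\<kappa> * ((1 - \<rho>\<^sup>2) * c 0)) \<le> (1 - \<rho>) * s"
      using \<rho> by (intro mult_left_mono) auto
    also have "\<dots> < (1 + \<rho>) * c 0"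
      using disc discriminant_iff[OF \<rho>(1,2) \<open>0 < s\<close> \<open>0 < c 0\<close>] by simp
    finally have "((1 - \<rho>) * (\<kappa> * (1 - \<rho>\<^sup>2))) * c 0 < (1 + \<rho>) * c 0"
      by (simp add: mult_ac)
    then show "\<kappa> * (1 - \<rho>)\<^sup>2 < 1"
      using \<open>0 < c 0\<close> \<rho> by (simp add: interval_bound_iff)
  next
    assume "\<kappa> * (1 - \<rho>)\<^sup>2 < 1"
    then have bound: "(1 - \<rho>) * (\<kappa> * (1 - \<rho>\<^sup>2)) < 1 + \<rho>"
      using \<rho> by (simp add: interval_bound_iff)
    \<comment> \<open>The point 1 lies strictly between \<open>(1 - \<rho>) / (1 + \<rho>)\<close>
      and its reciprocal. Raising it to \<open>\<kappa> * (1 - \<rho>\<^sup>2)\<close> where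
      necessary keeps it below the upper end by \<open>bound\<close>, and below
      \<open>\<kappa>\<close> since \<open>\<kappa> > 1\<close>.\<close>
    define t where "t = max 1 (\<kappa> * (1 - \<rho>\<^sup>2))"
    have "1 \<le> t" "\<kappa> * (1 - \<rho>\<^sup>2) \<le> t"
      by (simp_all add: t_def)
    have "t \<le> \<kappa>"
      using \<kappa> by (simp add: t_def)
    have t_upper: "(1 - \<rho>) * t < 1 + \<rho>"
      using bound \<rho> by (simp add: t_def max_def)
    have "1 - \<rho> < 1 + \<rho>" "1 + \<rho> \<le> (1 + \<rho>) * t"
      using \<rho> \<open>1 \<le> t\<close> by simp_all
    then have t_lower: "1 - \<rho> < (1 + \<rho>) * t"
      by linarith
    \<comment> \<open>With \<open>c 0 = 1\<close>, the value \<open>c 1\<close> solves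
      \<open>1 + c 1 * \<rho> = t / \<kappa>\<close>; it is nonpositive because
      \<open>t \<le> \<kappa>\<close>. The index 1 is available since
      \<open>l \<ge> 1\<close>.\<close>
    define c :: "nat \<Rightarrow> real" where
      "c i = (if i = 0 then 1 else if i = 1 then - (1 - t / \<kappa>) / \<rho> else 0)" for i
    define \<Lambda> :: "nat \<Rightarrow> real^'d^'d" where "\<Lambda> = restrict (\<lambda>i. c i *\<^sub>R mat 1) {0..l}"
    \<comment> \<open>Stated for arbitrary weights \<open>f\<close> to serve both sums of the
      multiplier constraints.\<close>
    have sum_c: "(\<Sum>i=0..l. c i * f i) = f 0 + - (1 - t / \<kappa>) / \<rho> * f 1" for f
    proof -
      have "(\<Sum>i=0..l. c i * f i) = (\<Sum>i\<in>{0, 1}. c i * f i)"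
        using \<open>l \<ge> 1\<close> by (intro sum.mono_neutral_right) (auto simp: c_def)
      then show ?thesis
        by (simp add: c_def)
    qed
    have sum_pos: "(\<Sum>i=0..l. c i * \<rho> ^ i) = t / \<kappa>"
      using \<rho> by (simp add: sum_c)
    \<comment> \<open>The sum with negative powers equals
      \<open>1 - (1 - t / \<kappa>) / \<rho>\<^sup>2\<close>, so this is exactly its
      nonnegativity.\<close>
    have "1 - t / \<kappa> \<le> \<rho>\<^sup>2"
      using \<open>\<kappa> * (1 - \<rho>\<^sup>2) \<le> t\<close> \<kappa> by (simp add: field_simps)
    then have "0 \<le> (\<Sum>i=0..l. c i * \<rho> powi (- int i))"
      unfolding sum_c using \<rho> by (simp add: power_int_minus field_simps power2_eq_square)
    moreover have "0 \<le> (\<Sum>i=0..l. c i * \<rho> ^ i)"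
      unfolding sum_pos using \<open>1 \<le> t\<close> \<kappa> by simp
    moreover have "c i \<le> 0" if "i \<in> {1..l}" for i
      using that \<rho> \<kappa> \<open>t \<le> \<kappa>\<close> by (simp add: c_def divide_nonpos_pos)
    ultimately have "\<Lambda> \<in> Lambda_r l \<rho>"
      unfolding Lambda_r_def \<Lambda>_def by (intro CollectI conjI exI[of _ c]) auto
    moreover have "t = \<kappa> * (\<Sum>i=0..l. c i * \<rho> ^ i)"
      using \<kappa> by (simp add: sum_pos)
    then have "?P \<Lambda>"
      unfolding \<open>\<kappa> = L / m\<close>[symmetric]
      using multiplier_matrix_pos_def_iff[of l \<Lambda> c \<rho> t \<kappa>] \<rho> \<open>1 \<le> t\<close> t_upper t_lower
        discriminant_iff[of \<rho> t 1]
      by (simp add: \<Lambda>_def c_def)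
    ultimately show "\<exists>\<Lambda>\<in>Lambda_r l \<rho>. ?P \<Lambda>"
      by blast
  qed
qed

end
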